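(* Let $n\geq0$ and $\underline{s}=(s_1,\ldots,s_n)\in\{+,-\}^n$. Let $\widetilde{A}_{\underline{s}}$ be the set of total cyclic orders $\pi$ on $\{0,1,\ldots,n+1\}$ such that for $1\leq i\leq n$, $(i-1,i,i+1)\in\pi$ if $s_i=+$ and $(i+1,i,i-1)\in\pi$ if $s_i=-$. Let $\widetilde{B}_{\underline{s}}$ be the set of all $(x_1,\ldots,x_{n+1})\in[0,1]^{n+1}$ such that for $1\leq i\leq n$, $x_i+x_{i+1}\leq1$ if $s_i=+$ and $x_i+x_{i+1}\geq1$ if $s_i=-$. Then $\widetilde{B}_{\underline{s}}$ is a lattice polytope and \[ (n+1)!\,\mathrm{vol}(\widetilde{B}_{\underline{s}})=\#\widetilde{A}_{\underline{s}}. \]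
   Context: A cyclic order on a set $X$ is a set $\pi\subset X^3$ satisfying: (i) $(x,y,z)\in\pi\Rightarrow(y,z,x)\in\pi$; (ii) $(x,y,z)\in\pi\Rightarrow(z,y,x)\notin\pi$; (iii) $(x,y,z),(x,z,u)\in\pi\Rightarrow(x,y,u)\in\pi$. It is total if for all distinct $x,y,z$, either $(x,y,z)\in\pi$ or $(z,y,x)\in\pi$. A lattice polytope is a polytope with vertices in the integer lattice; $\mathrm{vol}$ is Lebesgue measure. *)

theory Defs
  imports "HOL-Analysis.Analysis"
begin

definition cyclic_order_on :: "'a set \<Rightarrow> ('a \<times> 'a \<times> 'a) set \<Rightarrow> bool" where
  "cyclic_order_on X \<pi> \<longleftrightarrow>
     \<pi> \<subseteq> X \<times> X \<times> X \<and>
     (\<forall>x y z. (x, y, z) \<in> \<pi> \<longrightarrow> (y, z, x) \<in> \<pi>) \<and>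
     (\<forall>x y z. (x, y, z) \<in> \<pi> \<longrightarrow> (z, y, x) \<notin> \<pi>) \<and>
     (\<forall>x y z u. (x, y, z) \<in> \<pi> \<and> (x, z, u) \<in> \<pi> \<longrightarrow> (x, y, u) \<in> \<pi>)"

definition total_cyclic_order_on :: "'a set \<Rightarrow> ('a \<times> 'a \<times> 'a) set \<Rightarrow> bool" where
  "total_cyclic_order_on X \<pi> \<longleftrightarrow>
     cyclic_order_on X \<pi> \<and>
     (\<forall>x\<in>X. \<forall>y\<in>X. \<forall>z\<in>X. x \<noteq> y \<and> y \<noteq> z \<and> x \<noteq> z \<longrightarrow>
        (x, y, z) \<in> \<pi> \<or> (z, y, x) \<in> \<pi>)"

definition lattice_polytope :: "(real ^ 'd::finite) set \<Rightarrow> bool" where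
  "lattice_polytope P \<longleftrightarrow>
     polytope P \<and> (\<forall>v. v extreme_point_of P \<longrightarrow> (\<forall>j. v $ j \<in> \<int>))"

datatype sign = SPlus | SMinus

text \<open>A sign sequence of length \<open>n\<close> is a function on \<open>nat\<close> of which only the values at
  \<open>1, \<dots>, n\<close> are used.\<close>

definition A_tilde :: "nat \<Rightarrow> (nat \<Rightarrow> sign) \<Rightarrow> (nat \<times> nat \<times> nat) set set" where
  "A_tilde n s =
     {\<pi>. total_cyclic_order_on {0..n+1} \<pi> \<and>
         (\<forall>i\<in>{1..n}. (s i = SPlus \<longrightarrow> (i - 1, i, i + 1) \<in> \<pi>) \<and>
                     (s i = SMinus \<longrightarrow> (i + 1, i, i - 1) \<in> \<pi>))}"

text \<open>The space \<open>\<real>\<^bsup>n+1\<^esup>\<close> is \<open>real ^ 'd\<close>, where \<open>e\<close> is meant to be a bijection from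
  \<open>{1..n+1}\<close> onto the index type \<open>'d\<close>; the coordinate \<open>x\<^sub>i\<close> is then \<open>x $ e i\<close>.\<close>

definition B_tilde :: "nat \<Rightarrow> (nat \<Rightarrow> sign) \<Rightarrow> (nat \<Rightarrow> 'd) \<Rightarrow> (real ^ 'd::finite) set" where
  "B_tilde n s e =
     {x. (\<forall>i\<in>{1..n+1}. 0 \<le> x $ e i \<and> x $ e i \<le> 1) \<and>
         (\<forall>i\<in>{1..n}. (s i = SPlus \<longrightarrow> x $ e i + x $ e (i + 1) \<le> 1) \<and>
                     (s i = SMinus \<longrightarrow> x $ e i + x $ e (i + 1) \<ge> 1))}"

end

theory Submission
  imports Defs "HOL-Combinatorics.Permutations"
begin

text \<open>
  Put \<open>y\<^sub>0 = 0\<close> and let \<open>y\<^sub>i\<close> be the fractional part of \<open>x\<^sub>1 + \<dots> + x\<^sub>i\<close>, viewed as points on a circle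
  of length \<open>1\<close>. Then \<open>x\<^sub>i\<close> is the length of the arc from \<open>y\<^sub>i\<^sub>-\<^sub>1\<close> to \<open>y\<^sub>i\<close>, so \<open>x\<^sub>i + x\<^sub>i\<^sub>+\<^sub>1 \<le> 1\<close> says that
  \<open>y\<^sub>i\<^sub>-\<^sub>1, y\<^sub>i, y\<^sub>i\<^sub>+\<^sub>1\<close> are in cyclic order. Up to a null set the polytope is therefore the disjoint union,
  over the cyclic orders in question, of the sets of all \<open>x\<close> whose points \<open>y\<close> induce that order.
  On each such set the order determines which differences \<open>y\<^sub>i - y\<^sub>i\<^sub>-\<^sub>1\<close> wrap around, so it is a translate
  of the image, under a unimodular linear map, of the set of \<open>y\<close> in the unit cube whose coordinates are
  ordered in a prescribed way; the latter has volume \<open>1/(n+1)!\<close> by symmetry.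
\<close>

subsection \<open>Volume-preserving linear maps\<close>

text \<open>Both matrices have integer entries, so by the Leibniz formula both determinants are
  integers. Their product is 1, which forces each to be 1 or -1.\<close>

lemma abs_det_matrix_eq_1_of_int_inverse:
  fixes f g :: "real ^ 'd::finite \<Rightarrow> real ^ 'd"
  assumes "linear f" "linear g" and fg: "\<And>x. f (g x) = x"
    and fZ: "\<And>x j. (\<And>i. x $ i \<in> \<int>) \<Longrightarrow> f x $ j \<in> \<int>"
    and gZ: "\<And>x j. (\<And>i. x $ i \<in> \<int>) \<Longrightarrow> g x $ j \<in> \<int>"
  shows "\<bar>det (matrix f)\<bar> = 1"
proof -
  have det_Ints: "det (matrix h) \<in> \<int>"
    if "\<And>x j. (\<And>i. x $ i \<in> \<int>) \<Longrightarrow> h x $ j \<in> \<int>" for h :: "real ^ 'd \<Rightarrow> real ^ 'd"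
    unfolding det_def matrix_def
    by (intro Ints_sum Ints_mult Ints_prod Ints_of_int) (simp add: that axis_def)
  have "matrix f ** matrix g = mat 1"
    using matrix_compose[OF assms(2,1)] fg by (simp add: comp_def matrix_id_mat_1[unfolded id_def])
  then have "det (matrix f) * det (matrix g) = 1"
    by (metis det_I det_mul)
  moreover obtain a b where "det (matrix f) = of_int a" "det (matrix g) = of_int b"
    using det_Ints[of f] det_Ints[of g] fZ gZ by (metis Ints_cases)
  ultimately have "a * b = 1"
    by (metis of_int_eq_1_iff of_int_mult)
  then have "\<bar>a\<bar> = 1"
    by (metis abs_zmult_eq_1 abs_one)
  then show ?thesis
    using \<open>det (matrix f) = of_int a\<close> by (metis of_int_1 of_int_abs)
qed

lemma prod_Basis_cart: "(\<Prod>b\<in>Basis. x \<bullet> b) = (\<Prod>i\<in>UNIV. x $ i)" for x :: "real ^ 'n::finite"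
  by (simp add: Basis_vec_def cart_eq_inner_axis axis_eq_axis prod.UNION_disjoint)

text \<open>Lebesgue measure is determined by its values on open boxes, and the preimage of a box
  under a reindexing is a box with the same side lengths listed in another order.\<close>

lemma lborel_distr_reindex:
  fixes h :: "'a::finite \<Rightarrow> 'b::finite"
  assumes h: "bij h"
  shows "distr lborel borel (\<lambda>x :: real ^ 'b. (\<chi> i. x $ h i) :: real ^ 'a) = lborel"
proof (rule lborel_eqI[symmetric])
  let ?f = "\<lambda>x :: real ^ 'b. (\<chi> i. x $ h i) :: real ^ 'a"
  have meas: "?f \<in> borel_measurable borel"
    by (intro borel_measurable_continuous_onI continuous_on_vec_lambda continuous_on_component continuous_on_id)
  fix l u :: "real ^ 'a"
  assume le: "\<And>b. b \<in> Basis \<Longrightarrow> l \<bullet> b \<le> u \<bullet> b"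
  define l' u' where "l' = (\<chi> j. l $ inv h j)" and "u' = (\<chi> j. u $ inv h j)"
  have le': "l $ i \<le> u $ i" for i
    using le[of "axis i 1"] by (simp add: cart_eq_inner_axis axis_in_Basis_iff)
  have *: "?f -` box l u = box l' u'"
  proof -
    have "(\<forall>i. P i (h i)) \<longleftrightarrow> (\<forall>j. P (inv h j) j)" for P
      using h by (metis bij_inv_eq_iff)
    from this[of "\<lambda>i j. l $ i < _ $ j \<and> _ $ j < u $ i"] show ?thesis
      by (auto simp: mem_box_cart l'_def u'_def)
  qed
  have "emeasure (distr lborel borel ?f) (box l u) = emeasure lborel (box l' u')"
    using meas by (simp add: emeasure_distr *)
  also have "\<dots> = (\<Prod>j\<in>UNIV. (u' - l') $ j)"
  proof -
    have "l' \<bullet> b \<le> u' \<bullet> b" if "b \<in> Basis" for b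
      using that le' by (auto simp: Basis_vec_def inner_axis l'_def u'_def)
    then show ?thesis
      by (simp only: emeasure_lborel_box prod_Basis_cart)
  qed
  also have "(\<Prod>j\<in>UNIV. (u' - l') $ j) = (\<Prod>i\<in>UNIV. (u - l) $ i)"
    using prod.reindex_bij_betw[OF bij_imp_bij_inv[OF h], of "\<lambda>i. (u - l) $ i"]
    by (simp add: l'_def u'_def)
  finally show "emeasure (distr lborel borel ?f) (box l u) = (\<Prod>b\<in>Basis. (u - l) \<bullet> b)"
    by (simp only: prod_Basis_cart)
qed simp

text \<open>This serves two purposes: moving a set to another index type of the same size, and
  permuting the coordinates of a set within one space.\<close>

lemma measure_reindex_image:
  fixes h :: "'a::finite \<Rightarrow> 'b::finite" and S :: "(real ^ 'b) set"
  assumes h: "bij h" and S: "open S"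
  shows "open ((\<lambda>x. (\<chi> i. x $ h i) :: real ^ 'a) ` S)"
    and "measure lebesgue ((\<lambda>x. (\<chi> i. x $ h i) :: real ^ 'a) ` S) = measure lebesgue S"
proof -
  define f where "f = (\<lambda>x :: real ^ 'b. (\<chi> i. x $ h i) :: real ^ 'a)"
  define g where "g = (\<lambda>x :: real ^ 'a. (\<chi> j. x $ inv h j) :: real ^ 'b)"
  have gf: "g (f x) = x" and fg: "f (g y) = y" for x y
    using h by (simp_all add: f_def g_def vec_eq_iff bij_is_surj surj_f_inv_f bij_is_inj)
  have cont: "continuous_on UNIV f" "continuous_on UNIV g"
    unfolding f_def g_def by (intro continuous_on_vec_lambda continuous_on_component continuous_on_id)+
  have "f ` S = g -` S"
  proof (rule set_eqI)
    show "y \<in> f ` S \<longleftrightarrow> y \<in> g -` S" for y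
      using fg[of y, symmetric] by (auto simp: gf)
  qed
  then have op: "open (f ` S)"
    using cont S by (simp add: open_vimage)
  have meas: "f \<in> borel_measurable borel"
    by (intro borel_measurable_continuous_onI cont)
  have "measure lebesgue (f ` S) = measure (distr lborel borel f) (f ` S)"
    using op lborel_distr_reindex[OF h] by (simp add: f_def)
  also have "\<dots> = measure lborel (f -` f ` S)"
    using meas op by (subst measure_distr) auto
  also have "f -` f ` S = S"
    using gf by (metis inj_on_inverseI inj_vimage_image_eq)
  finally have "measure lebesgue (f ` S) = measure lebesgue S"
    using S by simp
  with op show "open ((\<lambda>x. (\<chi> i. x $ h i) :: real ^ 'a) ` S)"
    and "measure lebesgue ((\<lambda>x. (\<chi> i. x $ h i) :: real ^ 'a) ` S) = measure lebesgue S"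
    by (simp_all add: f_def)
qed

text \<open>The change-of-variables theorem of the library needs a well-ordered index type;
  this copy of an arbitrary finite index type provides one.\<close>

typedef (overloaded) ('d::finite) index = "{..<CARD('d)}"
  by (rule exI[of _ 0]) simp

instantiation index :: (finite) wellorder
begin

definition less_eq_index :: "'a index \<Rightarrow> 'a index \<Rightarrow> bool"
  where "i \<le> j \<longleftrightarrow> Rep_index i \<le> Rep_index j"

definition less_index :: "'a index \<Rightarrow> 'a index \<Rightarrow> bool"
  where "i < j \<longleftrightarrow> Rep_index i < Rep_index j"

instance
proof
  fix P :: "'a index \<Rightarrow> bool" and a
  assume step: "\<And>x. (\<And>y. y < x \<Longrightarrow> P y) \<Longrightarrow> P x"
  show "P a"
  proof (induction a rule: measure_induct_rule[of Rep_index])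
    case (less x)
    then show ?case
      using step[of x] by (simp add: less_index_def)
  qed
qed (auto simp: less_eq_index_def less_index_def Rep_index_inject)

end

instance index :: (finite) finite
proof
  have "finite (range (Rep_index :: 'a index \<Rightarrow> nat))"
    by (rule finite_subset[of _ "{..<CARD('a)}"]) (use Rep_index in blast, simp)
  then show "finite (UNIV :: 'a index set)"
    by (rule finite_imageD) (simp add: inj_on_def Rep_index_inject)
qed

lemma ex_bij_index: "\<exists>h :: 'd index \<Rightarrow> 'd::finite. bij h"
proof -
  have "CARD('d index) = CARD('d)"
    by (metis card_lessThan type_definition.card type_definition_index)
  then show ?thesis
    using finite_same_card_bij[of "UNIV :: 'd index set" "UNIV :: 'd set"] by simp
qed

text \<open>Conjugating \<open>f\<close> and \<open>g\<close> with the reindexing \<open>a\<close>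
  onto the index type \<open>'d index\<close> keeps both maps integral. There
  \<open>measure_linear_image\<close> scales the volume by a determinant of absolute value 1, and
  \<open>a\<close> itself preserves volume.\<close>

lemma measure_linear_image_int_inverse:
  fixes f g :: "real ^ 'd::finite \<Rightarrow> real ^ 'd"
  assumes f: "linear f" and g: "linear g" and fg: "\<And>x. f (g x) = x"
    and fZ: "\<And>x j. (\<And>i. x $ i \<in> \<int>) \<Longrightarrow> f x $ j \<in> \<int>"
    and gZ: "\<And>x j. (\<And>i. x $ i \<in> \<int>) \<Longrightarrow> g x $ j \<in> \<int>"
    and S: "open S" "bounded S"
  shows "f ` S \<in> lmeasurable" and "measure lebesgue (f ` S) = measure lebesgue S"
proof -
  have "surj f"
    using fg by (metis surjI)
  then have op: "open (f ` S)"
    using open_surjective_linear_image f S by blast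
  then show "f ` S \<in> lmeasurable"
    using f S by (intro lmeasurable_open bounded_linear_image) (auto simp: linear_linear)
  obtain h :: "'d index \<Rightarrow> 'd" where h: "bij h"
    using ex_bij_index by blast
  define a where "a = (\<lambda>x :: real ^ 'd. (\<chi> i. x $ h i) :: real ^ 'd index)"
  define b where "b = (\<lambda>x :: real ^ 'd index. (\<chi> j. x $ inv h j) :: real ^ 'd)"
  have ba: "b (a x) = x" and ab: "a (b y) = y" for x y
    using h by (simp_all add: a_def b_def vec_eq_iff bij_is_surj surj_f_inv_f bij_is_inj)
  have lin: "linear a" "linear b"
    by (auto simp: a_def b_def vec_eq_iff intro!: linearI)
  have aS: "open (a ` S)" "measure lebesgue (a ` S) = measure lebesgue S"
    unfolding a_def by (rule measure_reindex_image[OF h S(1)])+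
  have "a ` S \<in> lmeasurable"
    using aS(1) S lin by (intro lmeasurable_open bounded_linear_image) (auto simp: linear_linear)
  moreover have "linear (\<lambda>x. a (f (b x)))" "linear (\<lambda>x. a (g (b x)))"
    using linear_compose[OF linear_compose[OF lin(2) f] lin(1)]
      linear_compose[OF linear_compose[OF lin(2) g] lin(1)] by (simp_all add: comp_def)
  moreover have "a x $ i \<in> \<int>" if "\<And>j. x $ j \<in> \<int>" for x i
    using that by (simp add: a_def)
  moreover have "b x $ i \<in> \<int>" if "\<And>j. x $ j \<in> \<int>" for x i
    using that by (simp add: b_def)
  ultimately have "measure lebesgue ((\<lambda>x. a (f (b x))) ` (a ` S)) = measure lebesgue (a ` S)"
    using measure_linear_image[of "\<lambda>x. a (f (b x))" "a ` S"]
      abs_det_matrix_eq_1_of_int_inverse[of "\<lambda>x. a (f (b x))" "\<lambda>x. a (g (b x))"] fZ gZ fg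
    by (simp add: ab ba)
  moreover have "(\<lambda>x. a (f (b x))) ` (a ` S) = a ` (f ` S)"
    by (simp add: image_image ba)
  moreover have "measure lebesgue (a ` (f ` S)) = measure lebesgue (f ` S)"
    unfolding a_def by (rule measure_reindex_image[OF h op])
  ultimately show "measure lebesgue (f ` S) = measure lebesgue S"
    using aS by simp
qed

subsection \<open>Rankings and cyclic orders\<close>

text \<open>Along a strict linear order the sets of predecessors grow strictly, so counting
  predecessors is strictly monotone and injective.\<close>

lemma rank_permutation:
  fixes R :: "nat \<Rightarrow> nat \<Rightarrow> bool"
  assumes irrefl: "\<And>i. i \<in> {1..N} \<Longrightarrow> \<not> R i i"
    and trans: "\<And>i j k. \<lbrakk>i \<in> {1..N}; j \<in> {1..N}; k \<in> {1..N}; R i j; R j k\<rbrakk> \<Longrightarrow> R i k"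
    and total: "\<And>i j. \<lbrakk>i \<in> {1..N}; j \<in> {1..N}; i \<noteq> j\<rbrakk> \<Longrightarrow> R i j \<or> R j i"
  obtains p where "p permutes {1..N}" "\<And>i j. \<lbrakk>i \<in> {1..N}; j \<in> {1..N}\<rbrakk> \<Longrightarrow> p i < p j \<longleftrightarrow> R i j"
proof -
  \<comment> \<open>The successor shifts the ranks from 0..N-1 to 1..N; the identity outside this
    range is what \<open>permutes\<close> demands.\<close>
  define p where "p i = (if i \<in> {1..N} then Suc (card {j \<in> {1..N}. R j i}) else i)" for i
  have less: "p i < p j" if ij: "i \<in> {1..N}" "j \<in> {1..N}" "R i j" for i j
  proof -
    have "{k \<in> {1..N}. R k i} \<subset> {k \<in> {1..N}. R k j}"
      using ij irrefl trans by blast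
    then show ?thesis
      using ij by (simp add: p_def psubset_card_mono)
  qed
  have iff: "p i < p j \<longleftrightarrow> R i j" if "i \<in> {1..N}" "j \<in> {1..N}" for i j
    using less that total by (metis less_asym less_irrefl)
  have inj: "inj_on p {1..N}"
    by (rule inj_onI) (metis iff less_irrefl total)
  have "p i \<in> {1..N}" if i: "i \<in> {1..N}" for i
  proof -
    have "{j \<in> {1..N}. R j i} \<subset> {1..N}"
      using i irrefl by blast
    then have "card {j \<in> {1..N}. R j i} < N"
      using psubset_card_mono[of "{1..N}"] by simp
    then show ?thesis
      using i by (simp add: p_def)
  qed
  then have "p ` {1..N} = {1..N}"
    by (intro endo_inj_surj inj) auto
  then have "p permutes {1..N}"
    using inj by (intro bij_imp_permutes) (auto simp: bij_betw_def p_def)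
  with iff that show thesis by blast
qed

text \<open>The order recovers the values: exactly \<open>r i - 1\<close> indices have a value below
  \<open>r i\<close>.\<close>

lemma permutes_eq_if_order_iso:
  fixes p q :: "nat \<Rightarrow> nat"
  assumes p: "p permutes {1..N}" and q: "q permutes {1..N}"
    and iff: "\<And>i j. \<lbrakk>i \<in> {1..N}; j \<in> {1..N}\<rbrakk> \<Longrightarrow> p i < p j \<longleftrightarrow> q i < q j"
  shows "p = q"
proof -
  have card: "card {j \<in> {1..N}. r j < r i} = r i - 1"
    if r: "r permutes {1..N}" and i: "i \<in> {1..N}" for r i
  proof -
    have "r ` {j \<in> {1..N}. r j < r i} = {1..<r i}"
    proof (intro equalityI subsetI)
      fix k assume k: "k \<in> {1..<r i}"
      have "r i \<in> {1..N}"
        using permutes_in_image[OF r] i by blast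
      with k have "k \<in> {1..N}" by auto
      then obtain j where "j \<in> {1..N}" "k = r j"
        using permutes_image[OF r] by (metis imageE)
      with k show "k \<in> r ` {j \<in> {1..N}. r j < r i}" by auto
    next
      fix k assume "k \<in> r ` {j \<in> {1..N}. r j < r i}"
      then show "k \<in> {1..<r i}"
        using permutes_in_image[OF r] by auto
    qed
    then show ?thesis
      using card_image[of r "{j \<in> {1..N}. r j < r i}"] permutes_inj_on[OF r] by simp
  qed
  have "p i = q i" if i: "i \<in> {1..N}" for i
  proof -
    have "p i - 1 = q i - 1"
      using card[OF p i] card[OF q i] iff i by (metis (no_types, lifting) Collect_cong)
    moreover have "p i \<ge> 1" "q i \<ge> 1"
      using i permutes_in_image[OF p, of i] permutes_in_image[OF q, of i] by auto
    ultimately show ?thesis by simp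
  qed
  then show ?thesis
    using p q by (metis ext permutes_not_in)
qed

text \<open>The disjuncts are the three rotations of \<open>f a < f b < f c\<close>: the real line
  is closed up to a circle and traversed upwards.\<close>

definition cyclic_order_of :: "'a set \<Rightarrow> ('a \<Rightarrow> real) \<Rightarrow> ('a \<times> 'a \<times> 'a) set" where
  "cyclic_order_of X f = {(a, b, c). a \<in> X \<and> b \<in> X \<and> c \<in> X \<and>
     (f a < f b \<and> f b < f c \<or> f b < f c \<and> f c < f a \<or> f c < f a \<and> f a < f b)}"

lemma total_cyclic_order_of:
  assumes "inj_on f X"
  shows "total_cyclic_order_on X (cyclic_order_of X f)"
proof -
  have "f x \<noteq> f y" if "x \<in> X" "y \<in> X" "x \<noteq> y" for x y
    using assms that by (meson inj_onD)
  then show ?thesis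
    unfolding total_cyclic_order_on_def cyclic_order_on_def cyclic_order_of_def
    by (auto simp: neq_iff)
qed

text \<open>Cutting the circle at \<open>w\<close> turns a cyclic order into a linear order, where
  \<open>x\<close> precedes \<open>y\<close> if \<open>(w, x, y)\<close> belongs to it. A triple
  that avoids \<open>w\<close> is oriented as this linear order dictates, so triples through
  \<open>w\<close> determine all others.\<close>

lemma total_cyclic_order_on_subset:
  assumes "total_cyclic_order_on X \<pi>" "total_cyclic_order_on X \<rho>" "w \<in> X"
    and base: "\<And>x y. (w, x, y) \<in> \<pi> \<Longrightarrow> (w, x, y) \<in> \<rho>"
  shows "\<pi> \<subseteq> \<rho>"
proof -
  have X: "x \<in> X" "y \<in> X" "z \<in> X" and rot: "(y, z, x) \<in> \<pi>" and asym: "(z, y, x) \<notin> \<pi>"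
    if "(x, y, z) \<in> \<pi>" for x y z
    using that assms(1) unfolding total_cyclic_order_on_def cyclic_order_on_def by blast+
  have rot': "(y, z, x) \<in> \<rho>" if "(x, y, z) \<in> \<rho>" for x y z
    using that assms(2) unfolding total_cyclic_order_on_def cyclic_order_on_def by blast
  have tr: "(x, y, u) \<in> \<sigma>" if "(x, y, z) \<in> \<sigma>" "(x, z, u) \<in> \<sigma>" "\<sigma> \<in> {\<pi>, \<rho>}" for x y z u \<sigma>
  proof -
    have "total_cyclic_order_on X \<sigma>"
      using that(3) assms(1,2) by blast
    with that(1,2) show ?thesis
      unfolding total_cyclic_order_on_def cyclic_order_on_def by blast
  qed
  have total: "(x, y, z) \<in> \<pi> \<or> (x, z, y) \<in> \<pi>"
    if "x \<in> X" "y \<in> X" "z \<in> X" "x \<noteq> y" "y \<noteq> z" "x \<noteq> z" for x y z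
    using that assms(1) rot unfolding total_cyclic_order_on_def by metis
  have chain: "(x, y, z) \<in> \<sigma>" if "(w, x, y) \<in> \<sigma>" "(w, y, z) \<in> \<sigma>" "\<sigma> \<in> {\<pi>, \<rho>}" for x y z \<sigma>
  proof -
    have r: "(b, c, a) \<in> \<sigma>" if "(a, b, c) \<in> \<sigma>" for a b c
      using that \<open>\<sigma> \<in> {\<pi>, \<rho>}\<close> rot rot' by blast
    \<comment> \<open>Seen from \<open>y\<close>, the point \<open>z\<close> comes before
      \<open>w\<close> and \<open>w\<close> before \<open>x\<close>, so transitivity at
      \<open>y\<close> applies.\<close>
    have "(y, z, x) \<in> \<sigma>"
      using tr[OF r[OF that(2)] r[OF r[OF that(1)]] that(3)] .
    then show ?thesis
      using r by blast
  qed
  have "(a, b, c) \<in> \<rho>" if abc: "(a, b, c) \<in> \<pi>" for a b c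
  proof -
    have ne: "a \<noteq> b" "b \<noteq> c" "a \<noteq> c"
      using abc rot asym by metis+
    show ?thesis
    proof (cases "w \<in> {a, b, c}")
      case True
      then show ?thesis
        using abc base rot rot' by (metis empty_iff insert_iff)
    next
      case False
      \<comment> \<open>All three pairs are compared in the order cut at \<open>w\<close>. An
        arrangement matching a rotation of \<open>(a, b, c)\<close> transfers to
        \<open>\<rho>\<close> by \<open>chain\<close>; one matching a reversed triple contradicts
        asymmetry of \<open>\<pi>\<close>.\<close>
      then have "(w, a, b) \<in> \<pi> \<or> (w, b, a) \<in> \<pi>" "(w, b, c) \<in> \<pi> \<or> (w, c, b) \<in> \<pi>"
        "(w, a, c) \<in> \<pi> \<or> (w, c, a) \<in> \<pi>"
        using total assms(3) X[OF abc] ne by auto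
      moreover have False if "(w, x, y) \<in> \<pi>" "(w, y, z) \<in> \<pi>" "(z, y, x) \<in> \<pi>" for x y z
        using chain[OF that(1,2)] asym[OF that(3)] by simp
      moreover have "(x, y, z) \<in> \<rho>" if "(w, x, y) \<in> \<pi>" "(w, y, z) \<in> \<pi>" for x y z
        using chain[OF base[OF that(1)] base[OF that(2)]] by simp
      ultimately show ?thesis
        using abc rot rot' by metis
    qed
  qed
  then show ?thesis by auto
qed

lemma total_cyclic_order_on_eqI:
  assumes "total_cyclic_order_on X \<pi>" "total_cyclic_order_on X \<rho>" "w \<in> X"
    and "\<And>x y. (w, x, y) \<in> \<pi> \<longleftrightarrow> (w, x, y) \<in> \<rho>"
  shows "\<pi> = \<rho>"
  using total_cyclic_order_on_subset[of X \<pi> \<rho> w] total_cyclic_order_on_subset[of X \<rho> \<pi> w] assms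
  by blast

text \<open>The difference of the two sides without the correction term is an integer strictly
  between -2 and 1, hence 0 or -1. It is -1 exactly when the arc of length \<open>x\<close> passes
  the point 0; distinct endpoints rule out the ambiguous empty arc and full turn.\<close>

lemma frac_add_step:
  fixes u x :: real
  assumes "0 \<le> x" "x \<le> 1" "frac (u + x) \<noteq> frac u"
  shows "x = frac (u + x) - frac u + (if frac (u + x) < frac u then 1 else 0)"
proof -
  obtain k where k: "frac (u + x) - frac u - x = of_int k"
    by (rule that[of "\<lfloor>u\<rfloor> - \<lfloor>u + x\<rfloor>"]) (simp add: frac_def)
  have b: "0 \<le> frac u" "frac u < 1" "0 \<le> frac (u + x)" "frac (u + x) < 1"
    by (simp_all add: frac_lt_1)
  have "real_of_int k < 1" "real_of_int k > -2"
    using k b assms by linarith+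
  then have "k = 0 \<or> k = -1" by linarith
  then show ?thesis
    using k b assms by auto
qed

text \<open>Since 0 is the strict minimum of \<open>f\<close>, the two rotated disjuncts would need
  a value below \<open>f 0\<close> and cannot hold.\<close>

lemma cyclic_order_of_base:
  fixes f :: "nat \<Rightarrow> real"
  assumes "f 0 = 0" "\<And>i. i \<in> {1..N} \<Longrightarrow> 0 < f i"
  shows "(0, i, j) \<in> cyclic_order_of {0..N} f \<longleftrightarrow> i \<in> {1..N} \<and> j \<in> {1..N} \<and> f i < f j"
proof (cases "i \<in> {1..N} \<and> j \<in> {1..N}")
  case True
  then have "0 < f i" "0 < f j"
    using assms(2) by blast+
  with True show ?thesis
    using assms(1) unfolding cyclic_order_of_def by auto
next
  case False
  moreover have "0 \<le> f k" if "k \<in> {0..N}" for k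
    using that assms by (cases "k = 0") (auto intro: less_imp_le)
  then have "i \<noteq> 0 \<and> j \<noteq> 0 \<and> i \<le> N \<and> j \<le> N" if "(0, i, j) \<in> cyclic_order_of {0..N} f"
    using that assms(1) unfolding cyclic_order_of_def by (cases "i = 0"; cases "j = 0") (auto simp: leD)
  ultimately show ?thesis by auto
qed

text \<open>Cutting at 0 gives a strict linear order on 1..N, and the resulting ranking encodes the
  cyclic order as a permutation.\<close>

lemma total_cyclic_order_base:
  fixes N :: nat
  assumes \<pi>: "total_cyclic_order_on {0..N} \<pi>"
  shows total_cyclic_order_base_range: "(0, i, j) \<in> \<pi> \<Longrightarrow> i \<in> {1..N} \<and> j \<in> {1..N}"
    and total_cyclic_order_base_rank: "\<exists>p. p permutes {1..N} \<and>
          (\<forall>i\<in>{1..N}. \<forall>j\<in>{1..N}. p i < p j \<longleftrightarrow> (0, i, j) \<in> \<pi>)"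
proof -
  have sub: "\<pi> \<subseteq> {0..N} \<times> {0..N} \<times> {0..N}"
    and rot: "\<And>x y z. (x, y, z) \<in> \<pi> \<Longrightarrow> (y, z, x) \<in> \<pi>"
    and asym: "\<And>x y z. (x, y, z) \<in> \<pi> \<Longrightarrow> (z, y, x) \<notin> \<pi>"
    and tr: "\<And>x y z u. (x, y, z) \<in> \<pi> \<Longrightarrow> (x, z, u) \<in> \<pi> \<Longrightarrow> (x, y, u) \<in> \<pi>"
    and total: "\<And>x y z. \<lbrakk>x \<in> {0..N}; y \<in> {0..N}; z \<in> {0..N}; x \<noteq> y; y \<noteq> z; x \<noteq> z\<rbrakk> \<Longrightarrow>
                 (x, y, z) \<in> \<pi> \<or> (z, y, x) \<in> \<pi>"
    using \<pi> unfolding total_cyclic_order_on_def cyclic_order_on_def by blast+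
  \<comment> \<open>The triple \<open>(y, y, x)\<close> is both a rotation and the reversal of
    \<open>(x, y, y)\<close>.\<close>
  have irrefl: "(x, y, y) \<notin> \<pi>" for x y
    using asym rot by blast
  show "i \<in> {1..N} \<and> j \<in> {1..N}" if "(0, i, j) \<in> \<pi>"
  proof -
    have "i \<noteq> 0" "j \<noteq> 0"
      using rot[OF that] rot[OF rot[OF that]] irrefl by metis+
    moreover have "i \<in> {0..N}" "j \<in> {0..N}"
      using subsetD[OF sub that] by auto
    ultimately show ?thesis by simp
  qed
  show "\<exists>p. p permutes {1..N} \<and> (\<forall>i\<in>{1..N}. \<forall>j\<in>{1..N}. p i < p j \<longleftrightarrow> (0, i, j) \<in> \<pi>)"
  proof (rule rank_permutation[of N "\<lambda>i j. (0, i, j) \<in> \<pi>"])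
    fix i j assume "i \<in> {1..N}" "j \<in> {1..N}" "i \<noteq> j"
    then have "(0, i, j) \<in> \<pi> \<or> (j, i, 0) \<in> \<pi>"
      using total[of 0 i j] by auto
    then show "(0, i, j) \<in> \<pi> \<or> (0, j, i) \<in> \<pi>"
      using rot by blast
  qed (use irrefl tr in blast)+
qed

subsection \<open>Cells of the unit cube\<close>

lemma negligible_eq_components:
  fixes a b :: "'d::finite"
  assumes "a \<noteq> b"
  shows "negligible {y :: real ^ 'd. y $ a = y $ b}"
proof -
  have "axis a 1 - axis b 1 \<noteq> (0 :: real ^ 'd)"
    using assms by (auto simp: vec_eq_iff axis_def intro!: exI[of _ a])
  then have "negligible {y. (axis a 1 - axis b 1 :: real ^ 'd) \<bullet> y = 0}"
    by (intro negligible_hyperplane) simp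
  then show ?thesis
    by (simp add: inner_diff_left inner_axis')
qed

locale coord_enum =
  fixes N :: nat and e :: "nat \<Rightarrow> 'd::finite"
  assumes e: "bij_betw e {1..N} UNIV"
begin

definition idx :: "'d \<Rightarrow> nat"
  where "idx = inv_into {1..N} e"

lemma idx_e [simp]: "\<lbrakk>0 < i; i \<le> N\<rbrakk> \<Longrightarrow> idx (e i) = i"
  using e by (simp add: idx_def bij_betw_inv_into_left)

lemma e_idx [simp]: "e (idx d) = d"
  using e by (simp add: idx_def bij_betw_inv_into_right)

lemma idx_range [simp]: "idx d \<in> {1..N}" "0 < idx d" "idx d \<le> N" "idx d \<noteq> 0"
proof -
  show "idx d \<in> {1..N}"
    using bij_betw_inv_into[OF e] by (auto simp: idx_def dest: bij_betwE)
  then show "0 < idx d" "idx d \<le> N" "idx d \<noteq> 0" by auto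
qed

lemma bij_idx: "bij_betw idx UNIV {1..N}"
  unfolding idx_def using e by (rule bij_betw_inv_into)

lemma all_coord_iff: "(\<forall>d. P d) \<longleftrightarrow> (\<forall>i\<in>{1..N}. P (e i))"
  by (metis e_idx idx_range(1))

text \<open>These are the open simplices of the standard triangulation of the unit cube. The number
  \<open>p i\<close> is the rank of the coordinate \<open>e i\<close> among all coordinates.\<close>

definition order_cell :: "(nat \<Rightarrow> nat) \<Rightarrow> (real ^ 'd) set"
  where "order_cell p = {y. (\<forall>d. 0 < y $ d \<and> y $ d < 1) \<and>
           (\<forall>i\<in>{1..N}. \<forall>j\<in>{1..N}. p i < p j \<longrightarrow> y $ e i < y $ e j)}"

lemma order_cell_less_iff:
  assumes "p permutes {1..N}" "y \<in> order_cell p" "i \<in> {1..N}" "j \<in> {1..N}"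
  shows "y $ e i < y $ e j \<longleftrightarrow> p i < p j"
proof -
  have "p i = p j \<longleftrightarrow> i = j"
    using permutes_inj[OF assms(1)] by (simp add: inj_eq)
  then show ?thesis
    using assms unfolding order_cell_def by (auto simp: neq_iff dest: less_asym)
qed

lemma open_order_cell: "open (order_cell p)"
proof -
  have "order_cell p = (\<Inter>d. {y. 0 < y $ d} \<inter> {y. y $ d < 1}) \<inter>
          (\<Inter>i\<in>{1..N}. \<Inter>j\<in>{1..N}. if p i < p j then {y. y $ e i < y $ e j} else UNIV)"
    by (auto simp: order_cell_def split: if_splits)
  moreover have "open \<dots>"
    by (intro open_Int open_INT ballI) (auto intro!: open_Collect_less continuous_intros)
  ultimately show ?thesis by simp
qed

lemma bounded_order_cell: "bounded (order_cell p)"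
  by (rule bounded_subset[OF bounded_box[of 0 "\<chi> d. 1"]]) (auto simp: order_cell_def mem_box_cart)

text \<open>Sorting the coordinates carries any cell to the cell of increasing coordinates. The
  coordinate with rank \<open>k\<close> becomes the \<open>k\<close>-th one, so the sorted point
  \<open>z\<close> is read off through \<open>inv p\<close>.\<close>

lemma order_cell_eq_reindex:
  assumes p: "p permutes {1..N}"
  shows "order_cell p = (\<lambda>y. \<chi> d. y $ e (p (idx d))) ` order_cell id"
proof (intro equalityI subsetI)
  have pi: "p i \<in> {1..N} \<longleftrightarrow> i \<in> {1..N}" for i
    using permutes_in_image[OF p] .
  have ii: "inv p i \<in> {1..N} \<longleftrightarrow> i \<in> {1..N}" for i
    using permutes_in_image[OF permutes_inv[OF p]] .
  {
    fix y assume y: "y \<in> order_cell p"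
    define z where "z = (\<chi> d. y $ e (inv p (idx d)))"
    have "z \<in> order_cell id"
      using y ii by (auto simp: order_cell_def z_def permutes_inverses[OF p])
    moreover have "y = (\<chi> d. z $ e (p (idx d)))"
    proof (simp add: vec_eq_iff z_def, intro allI)
      fix d
      have "p (idx d) \<in> {1..N}"
        using pi idx_range(1) by blast
      then show "y $ d = y $ e (inv p (idx (e (p (idx d)))))"
        by (simp add: permutes_inverses[OF p])
    qed
    ultimately show "y \<in> (\<lambda>y. \<chi> d. y $ e (p (idx d))) ` order_cell id"
      by blast
  next
    fix y assume "y \<in> (\<lambda>y. \<chi> d. y $ e (p (idx d))) ` order_cell id"
    then obtain z where z: "z \<in> order_cell id" and y: "y = (\<chi> d. z $ e (p (idx d)))"
      by blast
    have "z $ e (p i) < z $ e (p j)" if "i \<in> {1..N}" "j \<in> {1..N}" "p i < p j" for i j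
      using z pi[of i] pi[of j] that unfolding order_cell_def id_def by blast
    then show "y \<in> order_cell p"
      using z by (simp add: order_cell_def y)
  }
qed

lemma measure_order_cell_eq_id:
  assumes p: "p permutes {1..N}"
  shows "measure lebesgue (order_cell p) = measure lebesgue (order_cell id)"
proof -
  have "bij (\<lambda>d. e (p (idx d)))"
    using bij_betw_trans[OF bij_betw_trans[OF bij_idx permutes_imp_bij[OF p]] e]
    by (simp add: comp_def)
  from measure_reindex_image(2)[OF this open_order_cell[of id]]
  show ?thesis
    by (simp add: order_cell_eq_reindex[OF p])
qed

lemma lmeasurable_order_cell: "order_cell p \<in> lmeasurable"
  by (intro lmeasurable_open open_order_cell bounded_order_cell)

text \<open>The \<open>fact N\<close> cells are disjoint, have equal volume by symmetry, and fill
  the unit cube except for points with two equal coordinates. Those points lie on finitely many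
  hyperplanes.\<close>

lemma measure_order_cell:
  assumes p: "p permutes {1..N}"
  shows "measure lebesgue (order_cell p) = 1 / fact N"
proof -
  let ?P = "{p. p permutes {1..N}}"
  let ?C = "\<Union>p\<in>?P. order_cell p"
  let ?U = "{y :: real ^ 'd. \<forall>d. 0 < y $ d \<and> y $ d < 1}"
  have fin: "finite ?P"
    by (simp add: finite_permutations)
  have disj: "disjoint_family_on order_cell ?P"
  proof (unfold disjoint_family_on_def, intro ballI impI equals0I)
    fix p q y assume "p \<in> ?P" "q \<in> ?P" "p \<noteq> q" "y \<in> order_cell p \<inter> order_cell q"
    then show False
      using permutes_eq_if_order_iso[of p N q] order_cell_less_iff[of p y] order_cell_less_iff[of q y]
      by auto
  qed
  have "?U - ?C \<subseteq> (\<Union>a. \<Union>b\<in>-{a}. {y. y $ a = y $ b})"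
  proof
    fix y assume y: "y \<in> ?U - ?C"
    show "y \<in> (\<Union>a. \<Union>b\<in>-{a}. {y. y $ a = y $ b})"
    proof (rule ccontr)
      assume "\<not> ?thesis"
      then have "y $ a \<noteq> y $ b" if "a \<noteq> b" for a b
        using that by auto
      then have neq: "y $ e i \<noteq> y $ e j" if "i \<in> {1..N}" "j \<in> {1..N}" "i \<noteq> j" for i j
        using that bij_betw_imp_inj_on[OF e] by (meson inj_onD)
      have "\<exists>p. p permutes {1..N} \<and> (\<forall>i\<in>{1..N}. \<forall>j\<in>{1..N}. p i < p j \<longleftrightarrow> y $ e i < y $ e j)"
      proof (rule rank_permutation[of N "\<lambda>i j. y $ e i < y $ e j"])
        fix i j assume "i \<in> {1..N}" "j \<in> {1..N}" "i \<noteq> j"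
        then show "y $ e i < y $ e j \<or> y $ e j < y $ e i"
          using neq[of i j] by linarith
      qed (auto intro: less_trans)
      with y show False
        by (auto simp: order_cell_def)
    qed
  qed
  moreover have "negligible (\<Union>a. \<Union>b\<in>-{a}. {y :: real ^ 'd. y $ a = y $ b})"
    by (intro negligible_Union) (auto intro!: negligible_Union negligible_eq_components)
  moreover have "?C - ?U = {}"
    by (auto simp: order_cell_def)
  ultimately have "negligible (?C - ?U \<union> (?U - ?C))"
    using negligible_subset by simp
  moreover have "?C \<in> lmeasurable"
    using fin by (intro fmeasurable.finite_UN lmeasurable_order_cell) auto
  ultimately have "measure lebesgue ?C = measure lebesgue ?U"
    by (intro measure_negligible_symdiff[symmetric])
  moreover have "x \<in> ?U \<longleftrightarrow> (\<forall>b\<in>Basis. 0 < x \<bullet> b \<and> x \<bullet> b < 1)" for x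
    by (auto simp: Basis_vec_def inner_axis)
  then have "?U = box 0 One"
    by (auto simp: mem_box)
  then have "measure lebesgue ?U = 1"
    by (simp add: measure_lborel_box_eq)
  moreover have "measure lebesgue ?C = (\<Sum>p\<in>?P. measure lebesgue (order_cell p))"
    using fin disj fmeasurableD[OF lmeasurable_order_cell] fmeasurableD2[OF lmeasurable_order_cell]
    by (intro measure_finite_Union) (auto simp del: emeasure_completion)
  moreover have "\<dots> = (\<Sum>q\<in>?P. measure lebesgue (order_cell p))"
    by (rule sum.cong[OF refl]) (metis measure_order_cell_eq_id p mem_Collect_eq)
  moreover have "card ?P = fact N"
    by (rule card_permutations) simp_all
  ultimately show ?thesis
    by (simp add: field_simps)
qed

section \<open>Partial sums and differences\<close>

definition coord :: "real ^ 'd \<Rightarrow> nat \<Rightarrow> real"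
  where "coord y i = (if i = 0 then 0 else y $ e i)"

definition psum :: "real ^ 'd \<Rightarrow> nat \<Rightarrow> real"
  where "psum x i = (\<Sum>k\<in>{1..i}. x $ e k)"

text \<open>The first entry is a difference as well, taken from the base point
  \<open>coord y 0 = 0\<close>. This makes the map unitriangular, hence volume preserving.\<close>

definition diffs :: "real ^ 'd \<Rightarrow> real ^ 'd"
  where "diffs y = (\<chi> d. coord y (idx d) - coord y (idx d - 1))"

definition sums_vec :: "real ^ 'd \<Rightarrow> real ^ 'd"
  where "sums_vec x = (\<chi> d. psum x (idx d))"

lemma psum_0 [simp]: "psum x 0 = 0"
  by (simp add: psum_def)

lemma psum_Suc [simp]: "psum x (Suc i) = psum x i + x $ e (Suc i)"
  by (simp add: psum_def)

lemma psum_diffs: "i \<le> N \<Longrightarrow> psum (diffs y) i = coord y i"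
  by (induction i) (auto simp: diffs_def coord_def)

lemma psum_add: "psum (x + y) i = psum x i + psum y i"
  by (simp add: psum_def sum.distrib)

text \<open>The partial sums telescope. This supplies the integral right inverse that
  \<open>measure_linear_image_int_inverse\<close> asks for.\<close>

lemma diffs_sums_vec: "diffs (sums_vec x) = x"
proof -
  have "coord (sums_vec x) i = psum x i" if "i \<le> N" for i
    using that by (cases "i = 0") (auto simp: coord_def sums_vec_def)
  then have "diffs (sums_vec x) $ d = psum x (idx d) - psum x (idx d - 1)" for d
    using le_trans[OF diff_le_self[of "idx d" 1] idx_range(3)[of d]] by (simp add: diffs_def)
  moreover have "psum x (idx d) - psum x (idx d - 1) = x $ d" for d
    using psum_Suc[of x "idx d - 1"] by simp
  ultimately show ?thesis
    by (simp add: vec_eq_iff)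
qed

lemma linear_diffs: "linear diffs"
  by (rule linearI) (auto simp: diffs_def coord_def vec_eq_iff algebra_simps)

lemma linear_sums_vec: "linear sums_vec"
  by (rule linearI) (auto simp: sums_vec_def psum_def vec_eq_iff sum.distrib sum_distrib_left)

lemma measure_diffs_order_cell:
  assumes "p permutes {1..N}"
  shows "diffs ` order_cell p \<in> lmeasurable" "measure lebesgue (diffs ` order_cell p) = 1 / fact N"
proof -
  have Z: "diffs x $ j \<in> \<int>" "sums_vec x $ j \<in> \<int>" if "\<And>i. x $ i \<in> \<int>" for x j
    using that by (auto simp: diffs_def coord_def sums_vec_def psum_def)
  note * = measure_linear_image_int_inverse[OF linear_diffs linear_sums_vec diffs_sums_vec Z
      open_order_cell bounded_order_cell]
  show "diffs ` order_cell p \<in> lmeasurable"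
    by (rule *(1))
  show "measure lebesgue (diffs ` order_cell p) = 1 / fact N"
    using *(2) measure_order_cell[OF assms] by simp
qed

section \<open>Cells of points inducing a given cyclic order\<close>

definition cyclic_cell :: "(nat \<times> nat \<times> nat) set \<Rightarrow> (real ^ 'd) set"
  where "cyclic_cell \<pi> = {x. (\<forall>d. 0 \<le> x $ d \<and> x $ d \<le> 1) \<and>
           inj_on (\<lambda>i. frac (psum x i)) {0..N} \<and>
           cyclic_order_of {0..N} (\<lambda>i. frac (psum x i)) = \<pi>}"

lemma frac_psum_step:
  assumes "0 \<le> x $ e (Suc i)" "x $ e (Suc i) \<le> 1" "inj_on (\<lambda>i. frac (psum x i)) {0..N}" "Suc i \<le> N"
  shows "x $ e (Suc i) = frac (psum x (Suc i)) - frac (psum x i) +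
           (if frac (psum x (Suc i)) < frac (psum x i) then 1 else 0)"
proof -
  have "frac (psum x (Suc i)) \<noteq> frac (psum x i)"
    using inj_onD[OF assms(3), of "Suc i" i] assms(4) by auto
  with assms(1,2) show ?thesis
    using frac_add_step[of "x $ e (Suc i)" "psum x i"] by simp
qed

text \<open>The arc ending at the \<open>i\<close>-th point wraps around 0 iff that point lies below
  its predecessor, that is, iff \<open>(0, i, i - 1)\<close> is in \<open>\<pi>\<close>. Hence
  \<open>x\<close> and \<open>diffs y\<close> differ by an integer vector that depends on
  \<open>\<pi>\<close> alone. Conversely, an integer translation leaves the fractional parts of the
  partial sums unchanged, so \<open>y\<close> is recovered from \<open>x\<close>.\<close>

lemma cyclic_cell_eq_image:
  assumes \<pi>: "total_cyclic_order_on {0..N} \<pi>" and p: "p permutes {1..N}"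
    and rank: "\<And>i j. \<lbrakk>i \<in> {1..N}; j \<in> {1..N}\<rbrakk> \<Longrightarrow> p i < p j \<longleftrightarrow> (0, i, j) \<in> \<pi>"
  shows "cyclic_cell \<pi> = (+) (\<chi> d. if (0, idx d, idx d - 1) \<in> \<pi> then 1 else 0) ` diffs ` order_cell p"
    (is "_ = (+) ?k ` _")
proof (intro equalityI subsetI)
  fix x assume "x \<in> cyclic_cell \<pi>"
  then have x: "\<And>d. 0 \<le> x $ d \<and> x $ d \<le> 1" and inj: "inj_on (\<lambda>i. frac (psum x i)) {0..N}"
    and cyc: "cyclic_order_of {0..N} (\<lambda>i. frac (psum x i)) = \<pi>"
    by (auto simp: cyclic_cell_def)
  define y where "y = (\<chi> d. frac (psum x (idx d)))"
  have coord_y: "coord y i = frac (psum x i)" if "i \<le> N" for i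
    using that by (auto simp: coord_def y_def)
  have pos: "0 < frac (psum x i)" if "i \<in> {1..N}" for i
  proof -
    have "frac (psum x i) \<noteq> frac (psum x 0)"
      using inj_onD[OF inj, of i 0] that by auto
    then show ?thesis
      using frac_ge_0[of "psum x i"] by (simp del: frac_ge_0 add: less_le)
  qed
  have base: "(0, i, j) \<in> \<pi> \<longleftrightarrow> i \<in> {1..N} \<and> j \<in> {1..N} \<and> frac (psum x i) < frac (psum x j)" for i j
    using cyclic_order_of_base[of "\<lambda>i. frac (psum x i)" N i j] pos cyc by simp
  have "y \<in> order_cell p"
  proof -
    have "0 < y $ d \<and> y $ d < 1" for d
      using pos[OF idx_range(1)] by (simp add: y_def frac_lt_1 del: frac_gt_0_iff)
    moreover have "y $ e i < y $ e j" if "i \<in> {1..N}" "j \<in> {1..N}" "p i < p j" for i j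
      using that rank[of i j] base[of i j] by (simp add: y_def)
    ultimately show ?thesis
      by (simp add: order_cell_def)
  qed
  moreover have "x = ?k + diffs y"
  proof (rule vec_eq_iff[THEN iffD2], rule allI)
    fix d
    define i where "i = idx d - 1"
    have i: "idx d = Suc i" "Suc i \<le> N" "e (Suc i) = d"
      using idx_range(2,3)[of d] e_idx[of d] by (auto simp: i_def)
    \<comment> \<open>For \<open>i = 0\<close> both sides are false: \<open>base\<close> excludes
      the index 0, and no fractional part lies below \<open>frac (psum x 0) = 0\<close>.\<close>
    have "(0, Suc i, i) \<in> \<pi> \<longleftrightarrow> frac (psum x (Suc i)) < frac (psum x i)"
      using i(2) base[of "Suc i" i] frac_ge_0[of "psum x (Suc i)"]
      by (cases "i = 0") (auto simp del: psum_Suc frac_ge_0)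
    moreover have "diffs y $ d = frac (psum x (Suc i)) - frac (psum x i)"
      using i coord_y by (simp add: diffs_def)
    ultimately show "x $ d = (?k + diffs y) $ d"
      using frac_psum_step[of x i] x inj i by simp
  qed
  ultimately show "x \<in> (+) ?k ` diffs ` order_cell p"
    by blast
next
  fix x assume "x \<in> (+) ?k ` diffs ` order_cell p"
  then obtain y where y: "y \<in> order_cell p" and xy: "x = ?k + diffs y"
    by blast
  have y01: "0 < y $ d" "y $ d < 1" for d
    using y by (auto simp: order_cell_def)
  then have coord01: "0 \<le> coord y i" "coord y i < 1" for i
    by (auto simp: coord_def intro: less_imp_le)
  have less: "(0, i, j) \<in> \<pi> \<longleftrightarrow> i \<in> {1..N} \<and> j \<in> {1..N} \<and> coord y i < coord y j" for i j
    using order_cell_less_iff[OF p y, of i j] rank[of i j] total_cyclic_order_base_range[OF \<pi>, of i j]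
    by (auto simp: coord_def)
  have frac: "frac (psum x i) = coord y i" if "i \<le> N" for i
  proof -
    have "psum ?k i \<in> \<int>"
      by (auto simp: psum_def)
    moreover have "psum x i = psum ?k i + coord y i"
      using that by (simp add: xy psum_add psum_diffs)
    ultimately show ?thesis
      using coord01[of i] by (simp add: frac_add_int_left frac_eq)
  qed
  have "0 \<le> x $ d \<and> x $ d \<le> 1" for d
  proof -
    have "x $ d = (if (0, idx d, idx d - 1) \<in> \<pi> then 1 else 0) + (coord y (idx d) - coord y (idx d - 1))"
      by (simp add: xy diffs_def)
    moreover have "(0, idx d, idx d - 1) \<in> \<pi> \<longleftrightarrow> coord y (idx d) < coord y (idx d - 1)"
    proof (cases "idx d = 1")
      case True
      then show ?thesis
        using less[of "idx d" "idx d - 1"] coord01[of "idx d"] by (simp add: coord_def)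
    next
      case False
      then have "idx d - 1 \<in> {1..N}"
        unfolding atLeastAtMost_iff using idx_range(2,3)[of d] by linarith
      then show ?thesis
        using less[of "idx d" "idx d - 1"] idx_range(1)[of d] by blast
    qed
    ultimately show ?thesis
      using coord01[of "idx d"] coord01[of "idx d - 1"] by auto
  qed
  moreover have inj: "inj_on (\<lambda>i. frac (psum x i)) {0..N}"
  proof (rule inj_onI)
    fix i j assume ij: "i \<in> {0..N}" "j \<in> {0..N}" "frac (psum x i) = frac (psum x j)"
    then have eq: "coord y i = coord y j"
      using frac by simp
    show "i = j"
    proof (cases "i = 0 \<or> j = 0")
      case True
      then show ?thesis
        using eq y01(1)[of "e i"] y01(1)[of "e j"] by (auto simp: coord_def split: if_splits)
    next
      case False
      then have "i \<in> {1..N}" "j \<in> {1..N}"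
        using ij by auto
      then have "p i = p j"
        using eq less[of i j] less[of j i] rank[of i j] rank[of j i] by (simp add: not_less)
      then show ?thesis
        using permutes_inj[OF p] by (simp add: inj_eq)
    qed
  qed
  \<comment> \<open>Two total cyclic orders agree once their triples starting at 0 agree.\<close>
  moreover have "cyclic_order_of {0..N} (\<lambda>i. frac (psum x i)) = \<pi>"
  proof (rule total_cyclic_order_on_eqI[of "{0..N}" _ _ 0])
    show "total_cyclic_order_on {0..N} (cyclic_order_of {0..N} (\<lambda>i. frac (psum x i)))"
      using inj by (rule total_cyclic_order_of)
    have "0 < frac (psum x i)" if "i \<in> {1..N}" for i
      using frac[of i] y01 that by (simp add: coord_def del: frac_gt_0_iff)
    then show "(0, i, j) \<in> cyclic_order_of {0..N} (\<lambda>i. frac (psum x i)) \<longleftrightarrow> (0, i, j) \<in> \<pi>" for i j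
      using cyclic_order_of_base[of "\<lambda>i. frac (psum x i)" N i j] less[of i j] frac by auto
  qed (use \<pi> in auto)
  ultimately show "x \<in> cyclic_cell \<pi>"
    by (simp add: cyclic_cell_def)
qed

lemma measure_cyclic_cell:
  assumes \<pi>: "total_cyclic_order_on {0..N} \<pi>"
  shows "cyclic_cell \<pi> \<in> lmeasurable" "measure lebesgue (cyclic_cell \<pi>) = 1 / fact N"
proof -
  obtain p where p: "p permutes {1..N}"
    "\<And>i j. \<lbrakk>i \<in> {1..N}; j \<in> {1..N}\<rbrakk> \<Longrightarrow> p i < p j \<longleftrightarrow> (0, i, j) \<in> \<pi>"
    using total_cyclic_order_base_rank[OF \<pi>] by blast
  have eq: "cyclic_cell \<pi> = (+) (\<chi> d. if (0, idx d, idx d - 1) \<in> \<pi> then 1 else 0) ` diffs ` order_cell p"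
    using \<pi> p by (rule cyclic_cell_eq_image)
  show "cyclic_cell \<pi> \<in> lmeasurable"
    unfolding eq by (rule measurable_translation[OF measure_diffs_order_cell(1)[OF p(1)]])
  show "measure lebesgue (cyclic_cell \<pi>) = 1 / fact N"
    unfolding eq measure_translation by (rule measure_diffs_order_cell[OF p(1)])
qed

text \<open>Two of the points coincide only if a block of consecutive coordinates has an integer
  sum, which confines \<open>x\<close> to countably many hyperplanes.\<close>

lemma negligible_not_inj_psum:
  "negligible {x. \<not> inj_on (\<lambda>i. frac (psum x i)) {0..N}}"
proof -
  define H where "H i j m = {x :: real ^ 'd. psum x j - psum x i = of_int m}" for i j and m :: int
  have "{x. \<not> inj_on (\<lambda>i. frac (psum x i)) {0..N}} \<subseteq> (\<Union>j\<in>{0..N}. \<Union>i\<in>{0..<j}. \<Union>m. H i j m)"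
  proof
    fix x assume "x \<in> {x. \<not> inj_on (\<lambda>i. frac (psum x i)) {0..N}}"
    then obtain i j where "i < j" "j \<le> N" "frac (psum x i) = frac (psum x j)"
      by (force simp: inj_on_def neq_iff)
    moreover from this(3) have "psum x j - psum x i = of_int (\<lfloor>psum x j\<rfloor> - \<lfloor>psum x i\<rfloor>)"
      by (simp add: frac_def)
    ultimately show "x \<in> (\<Union>j\<in>{0..N}. \<Union>i\<in>{0..<j}. \<Union>m. H i j m)"
      unfolding H_def by fastforce
  qed
  moreover have "negligible (H i j m)" if "i < j" "j \<le> N" for i j m
  proof -
    define a :: "real ^ 'd" where "a = (\<Sum>k\<in>{i<..j}. axis (e k) 1)"
    have split: "{1..j} = {1..i} \<union> {i<..j}"
      using \<open>i < j\<close> by auto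
    have "psum x j = psum x i + (\<Sum>k\<in>{i<..j}. x $ e k)" for x
      unfolding psum_def split by (rule sum.union_disjoint) auto
    then have "H i j m = {x. a \<bullet> x = of_int m}"
      by (simp add: H_def a_def inner_sum_left inner_axis')
    \<comment> \<open>The last coordinate of the block has coefficient 1, so the normal vector is
      nonzero and \<open>H i j m\<close> is a genuine hyperplane.\<close>
    moreover have "a $ e j = 1"
    proof -
      have "a $ e j = (\<Sum>k\<in>{i<..j}. if k = j then 1 else 0)"
        unfolding a_def sum_component
      proof (rule sum.cong)
        fix k assume "k \<in> {i<..j}"
        then have "e k = e j \<longleftrightarrow> k = j"
          using inj_onD[OF bij_betw_imp_inj_on[OF e], of k j] that by auto
        then show "axis (e k) 1 $ e j = (if k = j then 1 else (0 :: real))"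
          by (auto simp: axis_def)
      qed simp
      then show ?thesis
        using that by simp
    qed
    then have "a \<noteq> 0" by auto
    ultimately show ?thesis
      using negligible_hyperplane[of a "of_int m"] by simp
  qed
  then have "negligible (\<Union>j\<in>{0..N}. \<Union>i\<in>{0..<j}. \<Union>m. H i j m)"
    by (auto intro!: negligible_countable_Union)
  ultimately show ?thesis
    using negligible_subset by blast
qed

text \<open>With \<open>a\<close>, \<open>b\<close>, \<open>c\<close> the three consecutive points,
  the two arc lengths add up to \<open>c - a\<close> plus the number of wraps. The points are in
  cyclic order iff the two arcs together stay within one turn. A sum of exactly 1 would give
  \<open>a = c\<close>, so the two closed inequalities exclude each other here.\<close>

lemma consecutive_in_cyclic_order_iff:
  assumes x: "\<And>d. 0 \<le> x $ d \<and> x $ d \<le> 1" and inj: "inj_on (\<lambda>i. frac (psum x i)) {0..N}"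
    and i: "1 \<le> i" "i < N"
  shows "(i - 1, i, i + 1) \<in> cyclic_order_of {0..N} (\<lambda>i. frac (psum x i)) \<longleftrightarrow> x $ e i + x $ e (i + 1) \<le> 1"
    and "(i + 1, i, i - 1) \<in> cyclic_order_of {0..N} (\<lambda>i. frac (psum x i)) \<longleftrightarrow> 1 \<le> x $ e i + x $ e (i + 1)"
proof -
  obtain k where k: "i = Suc k"
    using i by (cases i) auto
  define a b c where "a = frac (psum x k)" "b = frac (psum x (Suc k))" "c = frac (psum x (Suc (Suc k)))"
  have "x $ e (Suc k) = b - a + (if b < a then 1 else 0)"
    "x $ e (Suc (Suc k)) = c - b + (if c < b then 1 else 0)"
    unfolding a_b_c_def using frac_psum_step[OF _ _ inj, of k] frac_psum_step[OF _ _ inj, of "Suc k"] x i k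
    by (simp_all del: psum_Suc)
  moreover have "a \<noteq> b" "b \<noteq> c" "a \<noteq> c"
    unfolding a_b_c_def using inj_onD[OF inj, of k "Suc k"] inj_onD[OF inj, of "Suc k" "Suc (Suc k)"]
      inj_onD[OF inj, of k "Suc (Suc k)"] i k by (auto simp del: psum_Suc)
  moreover have "0 \<le> a" "a < 1" "0 \<le> b" "b < 1" "0 \<le> c" "c < 1"
    by (simp_all add: a_b_c_def frac_lt_1 del: psum_Suc)
  moreover have "{k, Suc k, Suc (Suc k)} \<subseteq> {0..N}"
    using i k by auto
  ultimately show
    "(i - 1, i, i + 1) \<in> cyclic_order_of {0..N} (\<lambda>i. frac (psum x i)) \<longleftrightarrow> x $ e i + x $ e (i + 1) \<le> 1"
    "(i + 1, i, i - 1) \<in> cyclic_order_of {0..N} (\<lambda>i. frac (psum x i)) \<longleftrightarrow> 1 \<le> x $ e i + x $ e (i + 1)"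
    unfolding cyclic_order_of_def k by (auto simp: a_b_c_def[symmetric] simp del: psum_Suc split: if_splits)
qed

end

subsection \<open>The polytope\<close>

lemma polyhedron_B_tilde: "polyhedron (B_tilde n s (e :: nat \<Rightarrow> 'd::finite))"
proof -
  have le: "polyhedron {x :: real ^ 'd. a \<bullet> x \<le> b}" and ge: "polyhedron {x :: real ^ 'd. b \<le> a \<bullet> x}" for a b
    by (simp_all add: polyhedron_halfspace_le polyhedron_halfspace_ge)
  have comp_eq: "axis a 1 \<bullet> x = x $ a" for x :: "real ^ 'd" and a
    by (simp add: inner_axis')
  have cases: "(s i = SPlus \<longrightarrow> P) \<and> (s i = SMinus \<longrightarrow> Q) \<longleftrightarrow> (if s i = SPlus then P else Q)" for i P Q
    by (cases "s i") simp_all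
  have "B_tilde n s e = (\<Inter>i\<in>{1..n+1}. {x. 0 \<le> axis (e i) 1 \<bullet> x} \<inter> {x. axis (e i) 1 \<bullet> x \<le> 1}) \<inter>
     (\<Inter>i\<in>{1..n}. {x. if s i = SPlus then (axis (e i) 1 + axis (e (i + 1)) 1) \<bullet> x \<le> 1
                      else 1 \<le> (axis (e i) 1 + axis (e (i + 1)) 1) \<bullet> x})"
    (is "_ = ?I")
    unfolding B_tilde_def cases inner_add_left comp_eq by blast
  moreover have "polyhedron {x :: real ^ 'd. if P then a \<bullet> x \<le> 1 else 1 \<le> a \<bullet> x}" for P a
    by (cases P) (simp_all add: le ge)
  then have "polyhedron ?I"
    by (intro polyhedron_Int polyhedron_Inter finite_imageI finite_atLeastAtMost)
      (auto intro!: polyhedron_Int le ge)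
  ultimately show ?thesis by simp
qed

context coord_enum
begin

lemma bounded_B_tilde:
  assumes "n + 1 = N"
  shows "bounded (B_tilde n s e)"
proof (rule bounded_subset[OF bounded_cbox[of 0 "\<chi> d. 1"]])
  show "B_tilde n s e \<subseteq> cbox 0 (\<chi> d. 1)"
  proof
    fix x assume "x \<in> B_tilde n s e"
    then have "\<forall>d. 0 \<le> x $ d \<and> x $ d \<le> 1"
      using assms by (subst all_coord_iff) (simp add: B_tilde_def)
    then show "x \<in> cbox 0 (\<chi> d. 1)"
      by (simp add: mem_box_cart)
  qed
qed

text \<open>A point with a non-integral coordinate is the midpoint of its two perturbations by
  \<open>\<plusminus>\<epsilon>(-1)\<^sup>i\<close> along all its non-integral coordinates: if \<open>x\<^sub>i + x\<^sub>i\<^sub>+\<^sub>1 = 1\<close> then both of these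
  coordinates are integral or neither is, so tight constraints stay tight.\<close>

lemma extreme_point_B_tilde_Ints:
  assumes N: "n + 1 = N" and v: "v extreme_point_of B_tilde n s e"
  shows "v $ d \<in> \<int>"
proof (rule ccontr)
  assume d: "v $ d \<notin> \<int>"
  define w :: "real ^ 'd" where "w = (\<chi> a. if v $ a \<in> \<int> then 0 else (- 1) ^ idx a)"
  have vB: "v \<in> B_tilde n s e"
    using v by (simp add: extreme_point_of_def)
  have w_bound: "\<bar>w $ a\<bar> \<le> 1" for a
    by (simp add: w_def)
  \<comment> \<open>These are the gaps of the constraints that a perturbation could violate. The gap
    of a sum is halved because both of its summands may move by \<open>\<epsilon>\<close>.\<close>
  define slack where "slack = (\<lambda>a. min (v $ a) (1 - v $ a)) ` {a. v $ a \<notin> \<int>} \<union>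
     (\<lambda>i. \<bar>v $ e i + v $ e (i + 1) - 1\<bar> / 2) ` {i \<in> {1..n}. v $ e i + v $ e (i + 1) \<noteq> 1}"
  define \<epsilon> where "\<epsilon> = Min slack"
  have v01: "0 \<le> v $ a" "v $ a \<le> 1" for a
  proof -
    have "\<forall>a. 0 \<le> v $ a \<and> v $ a \<le> 1"
      using vB N by (subst all_coord_iff) (simp add: B_tilde_def)
    then show "0 \<le> v $ a" "v $ a \<le> 1" by auto
  qed
  have fin: "finite slack"
    by (simp add: slack_def)
  have ne: "slack \<noteq> {}"
    using d by (auto simp: slack_def)
  have "0 < t" if "t \<in> slack" for t
  proof -
    have "0 < min (v $ a) (1 - v $ a)" if "v $ a \<notin> \<int>" for a
    proof -
      have "v $ a \<noteq> 0" "v $ a \<noteq> 1"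
        using that by auto
      then show ?thesis
        using v01[of a] by simp
    qed
    with that show ?thesis
      by (auto simp: slack_def)
  qed
  then have \<epsilon>: "0 < \<epsilon>"
    using Min_in[OF fin ne] by (simp add: \<epsilon>_def)
  have \<epsilon>_le: "\<epsilon> \<le> t" if "t \<in> slack" for t
    using fin that by (simp add: \<epsilon>_def)
  have pert: "v + t *\<^sub>R w \<in> B_tilde n s e" if t: "\<bar>t\<bar> = \<epsilon>" for t
  proof -
    have tw: "\<bar>t * w $ a\<bar> \<le> \<epsilon>" for a
      using w_bound[of a] t \<epsilon> mult_left_mono[of "\<bar>w $ a\<bar>" 1 \<epsilon>] by (simp add: abs_mult)
    have box: "0 \<le> v $ a + t * w $ a \<and> v $ a + t * w $ a \<le> 1" for a
    proof (cases "v $ a \<in> \<int>")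
      case True
      then show ?thesis
        using v01[of a] by (simp add: w_def)
    next
      case False
      then have "\<epsilon> \<le> min (v $ a) (1 - v $ a)"
        by (intro \<epsilon>_le) (simp add: slack_def)
      then show ?thesis
        using tw[of a] by (simp add: abs_le_iff)
    qed
    \<comment> \<open>Both inequalities are preserved regardless of \<open>s i\<close>, so one
      argument serves both signs.\<close>
    have sum: "(v $ e i + v $ e (i + 1) \<le> 1 \<longrightarrow> v $ e i + t * w $ e i + (v $ e (i + 1) + t * w $ e (i + 1)) \<le> 1) \<and>
      (1 \<le> v $ e i + v $ e (i + 1) \<longrightarrow> 1 \<le> v $ e i + t * w $ e i + (v $ e (i + 1) + t * w $ e (i + 1)))"
      if i: "i \<in> {1..n}" for i
    proof (cases "v $ e i + v $ e (i + 1) = 1")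
      case True
      then have eq: "v $ e (i + 1) = 1 - v $ e i" "v $ e i = 1 - v $ e (i + 1)"
        by linarith+
      have "v $ e i \<in> \<int> \<longleftrightarrow> v $ e (i + 1) \<in> \<int>"
        using Ints_diff[OF Ints_1, of "v $ e i", folded eq(1)]
          Ints_diff[OF Ints_1, of "v $ e (i + 1)", folded eq(2)] by blast
      \<comment> \<open>Neighbouring indices have opposite parity, so the two perturbations cancel
        in the sum.\<close>
      moreover have "idx (e i) = i" "idx (e (i + 1)) = i + 1"
        using i N by (auto intro: idx_e)
      ultimately have "w $ e (i + 1) = - (w $ e i)"
        unfolding w_def by (cases "v $ e i \<in> \<int>") simp_all
      then have "v $ e i + t * w $ e i + (v $ e (i + 1) + t * w $ e (i + 1)) = v $ e i + v $ e (i + 1)"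
        by simp
      then show ?thesis by simp
    next
      case False
      then have slack: "\<epsilon> \<le> \<bar>v $ e i + v $ e (i + 1) - 1\<bar> / 2"
        using i by (intro \<epsilon>_le) (auto simp: slack_def)
      have bounds: "- \<epsilon> \<le> t * w $ a" "t * w $ a \<le> \<epsilon>" for a
        using tw[of a] by (simp_all add: abs_le_iff)
      show ?thesis
      proof (cases "v $ e i + v $ e (i + 1) < 1")
        case True
        then have "2 * \<epsilon> \<le> 1 - (v $ e i + v $ e (i + 1))"
          using slack by simp
        with True bounds(2)[of "e i"] bounds(2)[of "e (i + 1)"] show ?thesis
          by linarith
      next
        case gt: False
        then have "2 * \<epsilon> \<le> v $ e i + v $ e (i + 1) - 1"
          using slack by simp
        with False gt bounds(1)[of "e i"] bounds(1)[of "e (i + 1)"] show ?thesis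
          by linarith
      qed
    qed
    show ?thesis
      using box sum vB unfolding B_tilde_def by simp
  qed
  have "w $ d \<noteq> 0"
    using d by (simp add: w_def)
  then have "w \<noteq> 0" by auto
  have "v = midpoint (v + \<epsilon> *\<^sub>R w) (v + (- \<epsilon>) *\<^sub>R w)"
    by (simp add: midpoint_def vec_eq_iff)
  moreover have "v + \<epsilon> *\<^sub>R w \<noteq> v + (- \<epsilon>) *\<^sub>R w"
    using \<epsilon> \<open>w \<noteq> 0\<close> by (simp add: eq_neg_iff_add_eq_0 flip: scaleR_add_left)
  ultimately have "v \<in> open_segment (v + \<epsilon> *\<^sub>R w) (v + (- \<epsilon>) *\<^sub>R w)"
    by (metis midpoint_in_open_segment)
  with v pert[of \<epsilon>] pert[of "- \<epsilon>"] \<epsilon> show False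
    unfolding extreme_point_of_def by auto
qed

lemma lattice_polytope_B_tilde:
  assumes "n + 1 = N"
  shows "lattice_polytope (B_tilde n s e)"
  unfolding lattice_polytope_def polytope_eq_bounded_polyhedron
  using polyhedron_B_tilde bounded_B_tilde[OF assms] extreme_point_B_tilde_Ints[OF assms] by blast

text \<open>The cells of the orders in \<open>A_tilde n s\<close> are disjoint, each has volume
  \<open>1 / fact N\<close>, and together they fill the polytope up to the null set of
  \<open>negligible_not_inj_psum\<close>.\<close>

lemma measure_B_tilde:
  assumes N: "n + 1 = N"
  shows "measure lebesgue (B_tilde n s e) = real (card (A_tilde n s)) / fact N"
proof -
  let ?C = "\<Union>\<pi>\<in>A_tilde n s. cyclic_cell \<pi>"
  have total: "total_cyclic_order_on {0..N} \<pi>" if "\<pi> \<in> A_tilde n s" for \<pi>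
    using that N by (simp add: A_tilde_def)
  then have "A_tilde n s \<subseteq> Pow ({0..N} \<times> {0..N} \<times> {0..N})"
    unfolding total_cyclic_order_on_def cyclic_order_on_def by blast
  then have fin: "finite (A_tilde n s)"
    by (rule finite_subset) simp
  have disj: "disjoint_family_on cyclic_cell (A_tilde n s)"
    by (auto simp: disjoint_family_on_def cyclic_cell_def)
  \<comment> \<open>When the points are distinct, each sign condition on the induced cyclic order is
    the corresponding inequality between neighbouring coordinates.\<close>
  have B_iff: "x \<in> B_tilde n s e \<longleftrightarrow>
      cyclic_order_of {0..N} (\<lambda>i. frac (psum x i)) \<in> A_tilde n s \<and> (\<forall>d. 0 \<le> x $ d \<and> x $ d \<le> 1)"
    if inj: "inj_on (\<lambda>i. frac (psum x i)) {0..N}" for x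
  proof (cases "\<forall>d. 0 \<le> x $ d \<and> x $ d \<le> 1")
    case True
    have plus: "(i - 1, i, i + 1) \<in> cyclic_order_of {0..N} (\<lambda>i. frac (psum x i)) \<longleftrightarrow>
        x $ e i + x $ e (i + 1) \<le> 1"
      and minus: "(i + 1, i, i - 1) \<in> cyclic_order_of {0..N} (\<lambda>i. frac (psum x i)) \<longleftrightarrow>
        1 \<le> x $ e i + x $ e (i + 1)" if "i \<in> {1..n}" for i
      using consecutive_in_cyclic_order_iff[of x i] True inj that N by auto
    show ?thesis
      unfolding A_tilde_def B_tilde_def mem_Collect_eq N
      using True total_cyclic_order_of[OF inj] plus minus by blast
  next
    case False
    then have "\<not> (\<forall>i\<in>{1..n + 1}. 0 \<le> x $ e i \<and> x $ e i \<le> 1)"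
      unfolding all_coord_iff N .
    with False show ?thesis
      unfolding B_tilde_def by blast
  qed
  have "?C - B_tilde n s e = {}"
    using B_iff by (auto simp: cyclic_cell_def)
  moreover have "B_tilde n s e - ?C \<subseteq> {x. \<not> inj_on (\<lambda>i. frac (psum x i)) {0..N}}"
    using B_iff by (auto simp: cyclic_cell_def)
  ultimately have "negligible (?C - B_tilde n s e \<union> (B_tilde n s e - ?C))"
    using negligible_subset[OF negligible_not_inj_psum] by simp
  moreover have "?C \<in> lmeasurable"
    using fin total by (intro fmeasurable.finite_UN measure_cyclic_cell(1)) auto
  ultimately have "measure lebesgue (B_tilde n s e) = measure lebesgue ?C"
    by (intro measure_negligible_symdiff)
  also have "\<dots> = (\<Sum>\<pi>\<in>A_tilde n s. measure lebesgue (cyclic_cell \<pi>))"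
    using fin disj fmeasurableD[OF measure_cyclic_cell(1)] fmeasurableD2[OF measure_cyclic_cell(1)] total
    by (intro measure_finite_Union) (auto simp del: emeasure_completion)
  also have "\<dots> = (\<Sum>\<pi>\<in>A_tilde n s. 1 / fact N)"
    using measure_cyclic_cell(2) total by (intro sum.cong) auto
  finally show ?thesis by simp
qed

end

theorem theorem2p5:
  fixes n :: nat and s :: "nat \<Rightarrow> sign" and e :: "nat \<Rightarrow> 'd::finite"
  assumes "bij_betw e {1..n+1} (UNIV :: 'd set)"
  shows "lattice_polytope (B_tilde n s e) \<and>
         fact (n + 1) * measure lebesgue (B_tilde n s e) = real (card (A_tilde n s))"
proof -
  interpret coord_enum "n + 1" e
    using assms by unfold_locales
  show ?thesis
    using lattice_polytope_B_tilde[of n s] measure_B_tilde[of n s] by simp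
qed

end
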